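(* For all purely inseparable extensions $k\subseteq L\subseteq L'\subseteq K$, one has $di(L'/L)\le di(K/k)$.
   Context: All fields are commutative of characteristic $p>0$. A subset $B\subseteq K$ is an $r$-base of an extension $K/k$ if $K=k(K^p)(B)$ and, for every $x\in B$, $x\notin k(K^p)(B\setminus\{x\})$; every extension has an $r$-base and all $r$-bases of a given extension have the same cardinality. For a purely inseparable extension $K/k$ and $n\ge 1$, put $k_n=k^{p^{-n}}\cap K=\{x\in K: x^{p^n}\in k\}$ and let $B_n$ be an $r$-base of $k_n/k$. The degree of irrationality of $K/k$ is the cardinal $di(K/k)=\sup_{n\ge 1}|B_n|$ (supremum of cardinals). *)

theory Defs
  imports "HOL-Algebra.Algebra"
begin

unbundle cardinal_syntax

text \<open>
  All fields are subfields of an ambient field \<open>R\<close>, given as an HOL-Algebra structure;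
  an extension \<open>K/k\<close> is a pair of subfields of \<open>R\<close> with \<open>k \<subseteq> K\<close>.
  Cardinals are well-orders on sets, compared by \<open>\<le>o\<close>, as in the theories of BNF cardinals.
\<close>

subsection \<open>Suprema of cardinals\<close>

text \<open>The bound \<open>s'\<close> ranges over cardinals on the same type only; \<open>card_sup_least\<close> below
  shows that the supremum is below upper bounds on any other type as well.\<close>

definition is_card_sup :: "'a rel set \<Rightarrow> 'a rel \<Rightarrow> bool" where
  "is_card_sup C s \<longleftrightarrow> Card_order s \<and> (\<forall>c\<in>C. c \<le>o s) \<and>
     (\<forall>s'::'a rel. Card_order s' \<and> (\<forall>c\<in>C. c \<le>o s') \<longrightarrow> s \<le>o s')"

definition card_sup :: "'a rel set \<Rightarrow> 'a rel" where
  "card_sup C = (SOME s. is_card_sup C s)"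

lemma is_card_sup_card_sup:
  fixes C :: "'a rel set"
  assumes "\<And>c. c \<in> C \<Longrightarrow> Card_order c"
  shows "is_card_sup C (card_sup C)"
proof -
  let ?U = "{s::'a rel. Card_order s \<and> (\<forall>c\<in>C. c \<le>o s)}"
  have "c \<le>o |UNIV :: 'a set|" if "c \<in> C" for c
    using assms[OF that] card_of_mono1[OF subset_UNIV, of "Field c"]
      Card_order_iff_ordLeq_card_of ordLeq_transitive by blast
  then have "|UNIV :: 'a set| \<in> ?U"
    by (simp add: card_of_Card_order)
  then have "\<exists>s\<in>?U. \<forall>s'\<in>?U. s \<le>o s'"
    using exists_minim_Card_order[of ?U] by blast
  then have "\<exists>s. is_card_sup C s"
    unfolding is_card_sup_def by blast
  then show ?thesis
    unfolding card_sup_def by (rule someI_ex)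
qed

lemma card_sup_least:
  fixes C :: "'a rel set" and s' :: "'b rel"
  assumes C: "\<And>c. c \<in> C \<Longrightarrow> Card_order c"
    and s': "Card_order s'" "\<And>c. c \<in> C \<Longrightarrow> c \<le>o s'"
  shows "card_sup C \<le>o s'"
proof -
  note sup = is_card_sup_card_sup[OF C, unfolded is_card_sup_def]
  have "s' \<le>o card_sup C \<or> card_sup C \<le>o s'"
    using sup s'(1) by (simp add: ordLeq_total)
  moreover have "card_sup C \<le>o s'" if le: "s' \<le>o card_sup C"
  proof -
    obtain t :: "'a rel" where t: "s' =o t"
      using le internalize_ordLeq[of s' "card_sup C"] by blast
    then have "Card_order t" and "\<forall>c\<in>C. c \<le>o t"
      using s' Card_order_ordIso2 ordLeq_ordIso_trans by blast+
    then have "card_sup C \<le>o t"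
      using sup by blast
    then show ?thesis
      using t ordIso_symmetric ordLeq_ordIso_trans by blast
  qed
  ultimately show ?thesis
    by blast
qed

subsection \<open>Field extensions\<close>

definition has_char :: "('a, 'b) ring_scheme \<Rightarrow> nat \<Rightarrow> bool" where
  "has_char R p \<longleftrightarrow> (\<forall>n::nat. [n] \<cdot>\<^bsub>R\<^esub> \<one>\<^bsub>R\<^esub> = \<zero>\<^bsub>R\<^esub> \<longleftrightarrow> p dvd n)"

definition adjoin :: "('a, 'b) ring_scheme \<Rightarrow> 'a set \<Rightarrow> 'a set \<Rightarrow> 'a set" where
  "adjoin R F S = generate_field R (F \<union> S)"

definition pth_powers :: "('a, 'b) ring_scheme \<Rightarrow> nat \<Rightarrow> 'a set \<Rightarrow> 'a set" where
  "pth_powers R p K = (\<lambda>x. x [^]\<^bsub>R\<^esub> p) ` K"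

text \<open>In the predicates and functions below, the arguments \<open>K k\<close> stand for the extension \<open>K/k\<close>
  and \<open>p\<close> for the characteristic of \<open>R\<close>.\<close>

definition purely_inseparable ::
    "('a, 'b) ring_scheme \<Rightarrow> nat \<Rightarrow> 'a set \<Rightarrow> 'a set \<Rightarrow> bool" where
  "purely_inseparable R p K k \<longleftrightarrow> (\<forall>x\<in>K. \<exists>n::nat. x [^]\<^bsub>R\<^esub> (p ^ n) \<in> k)"

definition r_base ::
    "('a, 'b) ring_scheme \<Rightarrow> nat \<Rightarrow> 'a set \<Rightarrow> 'a set \<Rightarrow> 'a set \<Rightarrow> bool" where
  "r_base R p K k B \<longleftrightarrow> B \<subseteq> K \<and>
     K = adjoin R (adjoin R k (pth_powers R p K)) B \<and>
     (\<forall>x\<in>B. x \<notin> adjoin R (adjoin R k (pth_powers R p K)) (B - {x}))"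

definition root_layer ::
    "('a, 'b) ring_scheme \<Rightarrow> nat \<Rightarrow> 'a set \<Rightarrow> 'a set \<Rightarrow> nat \<Rightarrow> 'a set" where
  "root_layer R p K k n = {x \<in> K. x [^]\<^bsub>R\<^esub> (p ^ n) \<in> k}"

text \<open>Rather than choosing one r-base of \<open>k\<^sub>n/k\<close> for each \<open>n\<close>, the supremum is taken over all of
  them; for fixed \<open>n\<close> they exist and are equipotent, so they contribute one cardinal.\<close>

definition di :: "('a, 'b) ring_scheme \<Rightarrow> nat \<Rightarrow> 'a set \<Rightarrow> 'a set \<Rightarrow> 'a rel" where
  "di R p K k = card_sup {|B| | n B. 1 \<le> n \<and> r_base R p (root_layer R p K k n) k B}"

end

theory Submission
  imports Defs
begin

text \<open>
  The degree of irrationality is monotone because it can be read off finite subsets.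
  Fix a field of characteristic \<open>p\<close> and call \<open>Y\<close> independent over \<open>F\<close> if no \<open>y \<in> Y\<close> lies in
  \<open>F(Y - {y})\<close>. For the extension \<open>E/k\<close> with \<open>E = k(Y)\<close> one has \<open>k(E\<^sup>p) = k(Y\<^sup>p)\<close>, so \<open>Y\<close> is
  an r-base of \<open>k(Y)/k\<close> exactly if it is independent over \<open>k(Y\<^sup>p)\<close>. An r-base \<open>B\<close> of a root
  layer \<open>M\<close> of \<open>L'/L\<close> is independent over \<open>L(M\<^sup>p)\<close>, hence over the smaller field \<open>k(B\<^sup>p)\<close>, and
  the same holds for each subset of \<open>B\<close>: the field \<open>L\<close> disappears from the problem.

  The heart of the proof is \<open>card_le_card_generators\<close>: if \<open>T\<close> is finite and purely inseparable
  over \<open>k\<close>, and \<open>Y \<subseteq> k(T)\<close> is independent over \<open>k(Y\<^sup>p)\<close>, then \<open>|Y| \<le> |T|\<close>. It goes by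
  induction on \<open>T\<close>, moving one generator \<open>t\<close> at a time into the ground field; the point is
  \<open>indep_adjoin\<close>, by which this costs at most one element of \<open>Y\<close>, however large the exponent
  of \<open>t\<close> is. The tool is the exchange property \<open>pth_root_exchange\<close>: if \<open>x\<^sup>p \<in> F\<close> and
  \<open>y \<in> F(x) - F\<close> then \<open>x \<in> F(y)\<close>. It expresses that \<open>F(x)/F\<close> has prime degree \<open>p\<close> and rests on
  the irreducibility of \<open>X\<^sup>p - x\<^sup>p\<close> (\<open>degree_Irr_pth_root\<close>).

  Each root layer \<open>k\<^sub>m\<close> of \<open>K/k\<close> has an r-base \<open>C\<^sub>m\<close> (Zorn and exchange), and \<open>k\<^sub>m = k(C\<^sub>m)\<close>
  because \<open>k\<^sub>m/k\<close> has finite exponent (\<open>subset_gen_if_subset_gen_if_generated_by_pth_powers\<close>). Since \<open>K\<close> is the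
  union of the layers, each finite subset of \<open>B\<close> lies in \<open>k(T)\<close> for a finite subset \<open>T\<close> of a single
  \<open>C\<^sub>m\<close>. If \<open>di(K/k)\<close> is finite, this bounds the size of the finite subsets of \<open>B\<close>. If it is
  infinite, \<open>B\<close> is the union of the finite sets \<open>B \<inter> k(T)\<close> over the finite subsets \<open>T\<close> of
  \<open>\<Union>\<^sub>m C\<^sub>m\<close>, and there are at most \<open>di(K/k)\<close> of them.
\<close>

section \<open>Cardinal bounds from finite pieces\<close>

lemma finite_ordLeq_infinite:
  assumes "Card_order r" "infinite (Field r)" "finite A"
  shows "|A| \<le>o r"
proof (rule ordLess_imp_ordLeq)
  show "|A| <o r"
    using finite_ordLess_infinite[OF card_of_Well_order card_order_on_well_order_on[OF assms(1)]]
      assms(2,3) by (simp add: Field_card_of)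
qed

text \<open>Lists stand in for finite subsets of \<open>G\<close>: their number is bounded length by length.\<close>
lemma card_of_lists_ordLeq_infinite:
  assumes r: "Card_order r" "infinite (Field r)" and G: "|G| \<le>o r"
  shows "|lists G| \<le>o r"
proof -
  define S where "S n = {xs \<in> lists G. length xs = n}" for n
  have nat: "|UNIV :: nat set| \<le>o r"
    using infinite_iff_card_of_nat[of "Field r"] r(2) card_of_Field_ordIso[OF r(1)]
      ordLeq_ordIso_trans by blast
  have "|S n| \<le>o r" for n
  proof (induction n)
    case 0
    have "S 0 = {[]}" by (auto simp: S_def)
    then show ?case using finite_ordLeq_infinite[OF r, of "{[]}"] by simp
  next
    case (Suc n)
    have "S (Suc n) \<subseteq> (\<lambda>(x, xs). x # xs) ` (G \<times> S n)"
    proof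
      fix ys assume "ys \<in> S (Suc n)"
      then show "ys \<in> (\<lambda>(x, xs). x # xs) ` (G \<times> S n)"
        by (cases ys) (auto simp: S_def)
    qed
    then have "|S (Suc n)| \<le>o |G \<times> S n|"
      using card_of_mono1 card_of_image ordLeq_transitive by blast
    also have "|G \<times> S n| \<le>o r"
      using card_of_Times_ordLeq_infinite_Field[OF r(2) G Suc r(1)] .
    finally show ?case .
  qed
  then have "|\<Union>n\<in>UNIV. S n| \<le>o r"
    using card_of_UNION_ordLeq_infinite_Field[OF r(2,1) nat] by blast
  moreover have "(\<Union>n\<in>UNIV. S n) = lists G" by (auto simp: S_def)
  ultimately show ?thesis by simp
qed

text \<open>The set-theoretic half of the main argument: \<open>g T\<close> will be the field generated by \<open>T\<close>, and
  \<open>C m\<close> an r-base of the \<open>m\<close>-th layer. For finite \<open>r\<close> the union of the \<open>C m\<close> need not be bounded by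
  \<open>r\<close>, which is why each \<open>Z\<close> has to be covered from within a single \<open>C m\<close>.\<close>
lemma ordLeq_bounded_finite_pieces:
  assumes r: "Card_order r"
    and C: "\<And>m::nat. |C m| \<le>o r"
    and piece: "\<And>T. T \<subseteq> (\<Union>m. C m) \<Longrightarrow> finite T \<Longrightarrow> finite (B \<inter> g T) \<and> card (B \<inter> g T) \<le> card T"
    and cover: "\<And>Z. Z \<subseteq> B \<Longrightarrow> finite Z \<Longrightarrow> \<exists>m T. T \<subseteq> C m \<and> finite T \<and> Z \<subseteq> g T"
  shows "|B| \<le>o r"
proof (cases "finite (Field r)")
  case True
  have F: "|Field r| =o r" by (rule card_of_Field_ordIso[OF r])
  have bd: "finite (C m) \<and> card (C m) \<le> card (Field r)" for m
  proof -
    have le: "|C m| \<le>o |Field r|"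
      using C[of m] F ordIso_symmetric ordLeq_ordIso_trans by blast
    then have "finite (C m)" using True card_of_ordLeq_finite by blast
    then show ?thesis using le finite_card_of_iff_card2[of "C m" "Field r"] True by blast
  qed
  have "card Z \<le> card (Field r)" if Z: "Z \<subseteq> B" "finite Z" for Z
  proof -
    obtain m T where T: "T \<subseteq> C m" "finite T" "Z \<subseteq> g T" using cover[OF Z] by blast
    have p: "finite (B \<inter> g T)" "card (B \<inter> g T) \<le> card T"
      using piece[of T] T by blast+
    have "card Z \<le> card (B \<inter> g T)" using Z T p by (intro card_mono) auto
    also have "\<dots> \<le> card T" by (rule p(2))
    also have "\<dots> \<le> card (C m)" using T bd by (intro card_mono) auto
    also have "\<dots> \<le> card (Field r)" using bd by blast
    finally show ?thesis .
  qed
  then have "finite B" "card B \<le> card (Field r)"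
    using finite_if_finite_subsets_card_bdd[of B "card (Field r)"] by blast+
  then have "|B| \<le>o |Field r|" using finite_card_of_iff_card2[of B "Field r"] True by blast
  then show ?thesis using F ordLeq_ordIso_trans by blast
next
  case False
  let ?G = "\<Union>m. C m"
  have nat: "|UNIV :: nat set| \<le>o r"
    using infinite_iff_card_of_nat[of "Field r"] False card_of_Field_ordIso[OF r]
      ordLeq_ordIso_trans by blast
  then have "|?G| \<le>o r"
    using card_of_UNION_ordLeq_infinite_Field[OF False r nat, of C] C by blast
  then have L: "|lists ?G| \<le>o r"
    by (rule card_of_lists_ordLeq_infinite[OF r False])
  have "|B \<inter> g (set xs)| \<le>o r" if "xs \<in> lists ?G" for xs
  proof -
    have "finite (B \<inter> g (set xs))" using piece[of "set xs"] that by auto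
    then show ?thesis by (rule finite_ordLeq_infinite[OF r False])
  qed
  then have U: "|\<Union>xs\<in>lists ?G. B \<inter> g (set xs)| \<le>o r"
    by (intro card_of_UNION_ordLeq_infinite_Field[OF False r L] ballI)
  have "B \<subseteq> (\<Union>xs\<in>lists ?G. B \<inter> g (set xs))"
  proof
    fix x assume x: "x \<in> B"
    then have "\<exists>m T. T \<subseteq> C m \<and> finite T \<and> {x} \<subseteq> g T"
      by (intro cover) simp_all
    then obtain m T where T: "T \<subseteq> C m" "finite T" "{x} \<subseteq> g T"
      by blast
    from finite_list[OF T(2)] obtain xs where xs: "set xs = T" ..
    then have "xs \<in> lists ?G" "x \<in> B \<inter> g (set xs)"
      using T x by auto
    then show "x \<in> (\<Union>xs\<in>lists ?G. B \<inter> g (set xs))"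
      by (rule UN_I)
  qed
  then show ?thesis
    by (rule ordLeq_transitive[OF card_of_mono1 U])
qed

section \<open>The degree of irrationality as an upper bound\<close>

lemma is_card_sup_di:
  "is_card_sup {|B| | n B. 1 \<le> n \<and> r_base R p (root_layer R p K k n) k B} (di R p K k)"
  unfolding di_def by (rule is_card_sup_card_sup) (auto simp: card_of_Card_order)

lemma Card_order_di: "Card_order (di R p K k)"
  using is_card_sup_di[of R p K k] by (simp add: is_card_sup_def)

lemma r_base_ordLeq_di:
  assumes "1 \<le> n" "r_base R p (root_layer R p K k n) k B"
  shows "|B| \<le>o di R p K k"
proof -
  have "|B| \<in> {|B| | n B. 1 \<le> n \<and> r_base R p (root_layer R p K k n) k B}"
    using assms by blast
  then show ?thesis
    using is_card_sup_di[of R p K k] unfolding is_card_sup_def by simp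
qed

section \<open>Powers in prime characteristic\<close>

lemma (in cring) binomial:
  assumes x: "x \<in> carrier R" and y: "y \<in> carrier R"
  shows "(x \<oplus> y) [^] (n::nat) = (\<Oplus>i\<in>{..n}. add_pow R (n choose i) (x [^] i \<otimes> y [^] (n - i)))"
proof (induction n)
  case 0
  then show ?case using x y by simp
next
  case (Suc n)
  define t where "t i = x [^] i \<otimes> y [^] (Suc n - i)" for i
  let ?f = "\<lambda>n i. add_pow R (n choose i) (x [^] i \<otimes> y [^] (n - i))"
  have t: "t i \<in> carrier R" for i
    using x y by (simp add: t_def)
  have xs: "?f n i \<otimes> x = add_pow R (n choose i) (t (Suc i))" for i
    using x y by (simp add: t_def add_pow_ldistr add_pow_rdistr m_ac)
  have ys: "?f n i \<otimes> y = add_pow R (n choose i) (t i)" if "i \<in> {..n}" for i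
    using x y that by (simp add: t_def add_pow_ldistr add_pow_rdistr m_ac Suc_diff_le)
  have "(x \<oplus> y) [^] Suc n = (\<Oplus>i\<in>{..n}. ?f n i) \<otimes> x \<oplus> (\<Oplus>i\<in>{..n}. ?f n i) \<otimes> y"
    using Suc x y by (simp add: r_distr)
  also have "(\<Oplus>i\<in>{..n}. ?f n i) \<otimes> x = (\<Oplus>i\<in>{..n}. add_pow R (n choose i) (t (Suc i)))"
    using x y t by (subst finsum_ldistr) (auto intro!: finsum_cong' simp: xs)
  also have "(\<Oplus>i\<in>{..n}. ?f n i) \<otimes> y = (\<Oplus>i\<in>{..n}. add_pow R (n choose i) (t i))"
    using x y t by (subst finsum_ldistr) (auto intro!: finsum_cong' simp: ys)
  also have "\<dots> = (\<Oplus>i\<in>{..Suc n}. add_pow R (n choose i) (t i))"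
    using t by (simp add: Pi_def binomial_eq_0)
  also have "\<dots> = (\<Oplus>i\<in>{..n}. add_pow R (n choose Suc i) (t (Suc i))) \<oplus> t 0"
    using t by (subst finsum_Suc2) (auto simp del: finsum_Suc)
  also have "(\<Oplus>i\<in>{..n}. add_pow R (n choose i) (t (Suc i))) \<oplus> \<dots>
      = (\<Oplus>i\<in>{..n}. add_pow R (Suc n choose Suc i) (t (Suc i))) \<oplus> t 0"
    using t by (simp add: a_assoc[symmetric] finsum_addf[symmetric] add.nat_pow_mult Pi_def)
  also have "\<dots> = (\<Oplus>i\<in>{..Suc n}. add_pow R (Suc n choose i) (t i))"
    using t by (subst finsum_Suc2) (auto simp del: finsum_Suc)
  finally show ?case
    by (simp only: t_def)
qed

text \<open>The additivity of the Frobenius map is stated for rings, as it is applied both to the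
  field and to the polynomials over it.\<close>
lemma (in cring) power_char_add:
  fixes p :: nat
  assumes p: "Factorial_Ring.prime p" "add_pow R p \<one> = \<zero>"
    and x: "x \<in> carrier R" and y: "y \<in> carrier R"
  shows "(x \<oplus> y) [^] p = x [^] p \<oplus> y [^] p"
proof -
  obtain q where q: "p = Suc q" using p(1) prime_gt_0_nat gr0_implies_Suc by blast
  define f where "f i = add_pow R (p choose i) (x [^] i \<otimes> y [^] (p - i))" for i
  have f: "f i \<in> carrier R" for i using x y by (simp add: f_def)
  have z: "f (Suc i) = \<zero>" if "i < q" for i
  proof -
    have "p dvd (p choose Suc i)"
      using p(1) that q by (intro dvd_choose_prime) auto
    then obtain m where m: "p choose Suc i = m * p" by (metis dvd_def mult.commute)
    define z where "z = x [^] Suc i \<otimes> y [^] (p - Suc i)"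
    have zc: "z \<in> carrier R" using x y by (simp add: z_def)
    have "add_pow R p z = add_pow R p \<one> \<otimes> z" using zc by (simp add: add_pow_ldistr)
    then have "add_pow R p z = \<zero>" using p zc by simp
    then have "add_pow R (m * p) z = \<zero>"
      using add.nat_pow_pow[OF zc, of m p] by (simp add: mult.commute)
    then show ?thesis by (simp add: m z_def f_def)
  qed
  have "(x \<oplus> y) [^] p = (\<Oplus>i\<in>{..Suc q}. f i)"
    using binomial[OF x y, of p] unfolding f_def q .
  also have "\<dots> = (\<Oplus>i\<in>{..q}. f (Suc i)) \<oplus> f 0"
    using f by (subst finsum_Suc2) auto
  also have "(\<Oplus>i\<in>{..q}. f (Suc i)) = (\<Oplus>i\<in>{..q}. if q = i then f p else \<zero>)"
    using f z q by (intro finsum_cong') auto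
  also have "\<dots> = f p" using f by (subst add.finprod_singleton) auto
  finally show ?thesis using x y by (simp add: f_def)
qed

text \<open>A power of a linear polynomial has only the obvious monic divisors, since a linear polynomial
  divides a product exactly if its root is a root of one of the factors.\<close>
lemma (in domain) monic_divisor_of_linear_power:
  assumes a: "a \<in> carrier R"
    and "g \<in> carrier (poly_ring R)" "h \<in> carrier (poly_ring R)"
    and "g \<otimes>\<^bsub>poly_ring R\<^esub> h = [\<one>, a] [^]\<^bsub>poly_ring R\<^esub> (n::nat)" and "lead_coeff g = \<one>"
  shows "\<exists>j\<le>n. g = [\<one>, a] [^]\<^bsub>poly_ring R\<^esub> j"
  using assms(2-)
proof (induction n arbitrary: g h)
  case 0
  interpret UP: domain "poly_ring R"
    using univ_poly_is_domain[OF carrier_is_subring] .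
  have "g \<in> Units (poly_ring R)"
    using 0 UP.m_comm[OF 0(1,2)] unfolding Units_def by auto
  then obtain k where "g = [k]" using univ_poly_carrier_units_incl by blast
  then show ?case using 0(4) by (simp add: univ_poly_one)
next
  case (Suc n)
  interpret UP: domain "poly_ring R"
    using univ_poly_is_domain[OF carrier_is_subring] .
  let ?P = "[\<one>, a]"
  have P: "?P \<in> carrier (poly_ring R)"
    using a unfolding univ_poly_carrier[symmetric] polynomial_def by auto
  have P0: "?P \<noteq> \<zero>\<^bsub>poly_ring R\<^esub>" by (simp add: univ_poly_zero)
  interpret ev: ring_hom_cring "poly_ring R" R "\<lambda>q. eval q (\<ominus> a)"
    using eval_cring_hom[OF carrier_is_subring] a by simp
  have gh0: "g \<noteq> []" "h \<noteq> []"
  proof -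
    have "g \<otimes>\<^bsub>poly_ring R\<^esub> h \<noteq> []"
      using Suc.prems(3) polynomial_pow_not_zero[OF P, of "Suc n"] by (simp del: UP.nat_pow_Suc)
    then show "g \<noteq> []" "h \<noteq> []"
      using Suc.prems(1,2) UP.l_null UP.r_null by (auto simp: univ_poly_zero)
  qed
  have div: "\<exists>q\<in>carrier (poly_ring R). f = ?P \<otimes>\<^bsub>poly_ring R\<^esub> q"
    if "f \<in> carrier (poly_ring R)" "f \<noteq> []" "eval f (\<ominus> a) = \<zero>" for f
    using is_root_imp_pdivides[OF that(1), of "\<ominus> a"] that a
    by (auto simp: is_root_def pdivides_def factor_def)
  have "eval ?P (\<ominus> a) = \<zero>" using a by (simp add: l_neg)
  then have "eval g (\<ominus> a) \<otimes> eval h (\<ominus> a) = \<zero>"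
    using Suc.prems P ev.hom_mult[OF Suc.prems(1,2)] by simp
  then consider "eval g (\<ominus> a) = \<zero>" | "eval h (\<ominus> a) = \<zero>"
    using integral Suc.prems by auto
  then show ?case
  proof cases
    case 1
    then obtain q where q: "q \<in> carrier (poly_ring R)" "g = ?P \<otimes>\<^bsub>poly_ring R\<^esub> q"
      using div Suc.prems gh0 by blast
    have q0: "q \<noteq> []" using gh0 q P UP.r_null[OF P] by (auto simp: univ_poly_zero)
    have "lead_coeff g = lead_coeff ?P \<otimes> lead_coeff q"
      unfolding q(2) univ_poly_mult using P q q0
      by (intro poly_mult_lead_coeff[OF carrier_is_subring]) (auto simp: univ_poly_carrier)
    moreover have "lead_coeff q \<in> carrier R"
      using q(1) q0 lead_coeff_in_carrier[OF carrier_is_subring] by (cases q) (auto simp: univ_poly_carrier[symmetric])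
    ultimately have "lead_coeff q = \<one>" using Suc.prems(4) by simp
    moreover have "?P \<otimes>\<^bsub>poly_ring R\<^esub> (q \<otimes>\<^bsub>poly_ring R\<^esub> h) = ?P \<otimes>\<^bsub>poly_ring R\<^esub> (?P [^]\<^bsub>poly_ring R\<^esub> n)"
      using Suc.prems q P by (simp add: UP.m_assoc UP.m_comm UP.m_lcomm)
    then have "q \<otimes>\<^bsub>poly_ring R\<^esub> h = ?P [^]\<^bsub>poly_ring R\<^esub> n"
      using UP.m_lcancel[OF P0 P] q Suc.prems P by simp
    ultimately obtain j where "j \<le> n" "q = ?P [^]\<^bsub>poly_ring R\<^esub> j"
      using Suc.IH[OF q(1) Suc.prems(2)] by blast
    then show ?thesis using q(2) P UP.m_comm by (intro exI[of _ "Suc j"]) simp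
  next
    case 2
    then obtain q where q: "q \<in> carrier (poly_ring R)" "h = ?P \<otimes>\<^bsub>poly_ring R\<^esub> q"
      using div Suc.prems gh0 by blast
    have "?P \<otimes>\<^bsub>poly_ring R\<^esub> (g \<otimes>\<^bsub>poly_ring R\<^esub> q) = ?P \<otimes>\<^bsub>poly_ring R\<^esub> (?P [^]\<^bsub>poly_ring R\<^esub> n)"
      using Suc.prems q P by (simp add: UP.m_lcomm UP.m_comm)
    then have "g \<otimes>\<^bsub>poly_ring R\<^esub> q = ?P [^]\<^bsub>poly_ring R\<^esub> n"
      using UP.m_lcancel[OF P0 P] q Suc.prems P by simp
    then obtain j where "j \<le> n" "g = ?P [^]\<^bsub>poly_ring R\<^esub> j"
      using Suc.IH[OF Suc.prems(1) q(1)] Suc.prems by blast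
    then show ?thesis by (intro exI[of _ j]) simp
  qed
qed

locale char_p_field = field R for R (structure) +
  fixes p :: nat
  assumes char: "has_char R p" and char_pos: "p > 0"
begin

abbreviation gen :: "'a set \<Rightarrow> 'a set" where
  "gen \<equiv> generate_field R"

abbreviation frob :: "'a \<Rightarrow> 'a" where
  "frob x \<equiv> x [^] p"

lemma char_iff: "add_pow R n \<one> = \<zero> \<longleftrightarrow> p dvd n"
  using char unfolding has_char_def by blast

lemma p_one: "add_pow R p \<one> = \<zero>"
  using char_iff[of p] by simp

lemma prime_char: "Factorial_Ring.prime p"
proof -
  have "p \<noteq> 1"
  proof
    assume "p = 1"
    then have "\<one> = \<zero>"
      using p_one by simp
    then show False
      using one_not_zero by blast
  qed
  moreover have "m = 1 \<or> m = p" if m: "m dvd p" for m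
  proof -
    obtain n where n: "p = m * n" using m by (auto simp: dvd_def)
    have "add_pow R m \<one> \<otimes> add_pow R n \<one> = add_pow R p \<one>"
      using add.nat_pow_pow[of \<one> n m] by (simp add: n add_pow_rdistr mult.commute[of m n])
    then have "add_pow R m \<one> = \<zero> \<or> add_pow R n \<one> = \<zero>"
      using p_one integral by auto
    then have "p dvd m \<or> p dvd n"
      unfolding char_iff .
    then show ?thesis
    proof
      assume "p dvd m"
      then show ?thesis using m by (auto intro: dvd_antisym)
    next
      assume "p dvd n"
      moreover have "n dvd p" using n by simp
      ultimately have "n = p" by (auto intro: dvd_antisym)
      then show ?thesis using n char_pos by simp
    qed
  qed
  moreover from \<open>p \<noteq> 1\<close> have "1 < p"
    using char_pos by linarith
  ultimately show ?thesis
    unfolding prime_nat_iff by blast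
qed

lemma frob_add: "x \<in> carrier R \<Longrightarrow> y \<in> carrier R \<Longrightarrow> frob (x \<oplus> y) = frob x \<oplus> frob y"
  using power_char_add[OF prime_char p_one] .

lemma frob_zero: "frob \<zero> = \<zero>"
  using nat_pow_zero[of p] char_pos by simp

lemma frob_uminus: "x \<in> carrier R \<Longrightarrow> frob (\<ominus> x) = \<ominus> frob x"
  using frob_add[of "\<ominus> x" x] frob_zero minus_equality[of "frob (\<ominus> x)" "frob x"]
  by (simp add: l_neg)

lemma frob_gen:
  assumes S: "S \<subseteq> carrier R" and x: "x \<in> gen S"
  shows "frob x \<in> gen (frob ` S)"
  using x
proof induction
  case (m_inv h)
  have h: "h \<in> carrier R" using m_inv S generate_field_in_carrier by blast
  then have u: "h \<in> Units R" using m_inv field_Units by blast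
  have "frob h \<in> Units R" using Units_pow_closed[OF u] .
  then have ne: "frob h \<noteq> \<zero>" using field_Units by blast
  have "inv h \<in> carrier R" using u by simp
  then have "frob h \<otimes> frob (inv h) = \<one>"
    using u h by (simp add: nat_pow_distrib[symmetric])
  then have "inv (frob h) = frob (inv h)"
    using comm_inv_char[of "frob h" "frob (inv h)"] u h by simp
  then show ?case using generate_field.m_inv[OF m_inv.IH ne] by simp
next
  case (a_inv h)
  then have "h \<in> carrier R" using S generate_field_in_carrier by blast
  then show ?case using generate_field.a_inv[OF a_inv.IH] by (simp add: frob_uminus)
next
  case (eng_add h1 h2)
  then have "h1 \<in> carrier R" "h2 \<in> carrier R" using S generate_field_in_carrier by blast+
  then show ?case using generate_field.eng_add[OF eng_add.IH] by (simp add: frob_add)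
next
  case (eng_mult h1 h2)
  then have "h1 \<in> carrier R" "h2 \<in> carrier R" using S generate_field_in_carrier by blast+
  then show ?case using generate_field.eng_mult[OF eng_mult.IH] by (simp add: nat_pow_distrib)
qed (auto intro: generate_field.intros)

section \<open>Generated subfields\<close>

lemma gen_subfield: "S \<subseteq> carrier R \<Longrightarrow> subfield (gen S) R"
  by (rule generate_field_is_subfield)

lemma gen_carrier: "S \<subseteq> carrier R \<Longrightarrow> gen S \<subseteq> carrier R"
  by (rule generate_field_incl)

lemma subset_gen: "S \<subseteq> gen S"
  by (auto intro: generate_field.incl)

lemma gen_least:
  assumes "S \<subseteq> gen T" "T \<subseteq> carrier R"
  shows "gen S \<subseteq> gen T"
proof (rule generate_field_min_subfield1)
  show "S \<subseteq> carrier R" using assms gen_carrier[of T] by simp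
qed (use assms gen_subfield in auto)

lemma gen_mono: "S \<subseteq> T \<Longrightarrow> T \<subseteq> carrier R \<Longrightarrow> gen S \<subseteq> gen T"
  by (rule mono_generate_field)

lemma gen_subfield_eq:
  assumes "subfield E R"
  shows "gen E = E"
  using generate_field_min_subfield1[OF subfieldE(3)[OF assms] assms] subset_gen[of E] by simp

lemma gen_insert_absorb:
  assumes "x \<in> gen S" "S \<subseteq> carrier R"
  shows "gen (insert x S) = gen S"
proof
  show "gen (insert x S) \<subseteq> gen S"
    using assms subset_gen[of S] by (intro gen_least) auto
  show "gen S \<subseteq> gen (insert x S)"
    using assms gen_carrier[of S] by (intro gen_mono) auto
qed

lemma gen_finitary:
  assumes "x \<in> gen S" and S: "S \<subseteq> carrier R"
  obtains T where "T \<subseteq> S" "finite T" "x \<in> gen T"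
proof -
  have join: "\<exists>T\<subseteq>S. finite T \<and> a \<in> gen T \<and> b \<in> gen T"
    if ab: "\<exists>T\<subseteq>S. finite T \<and> a \<in> gen T" "\<exists>T\<subseteq>S. finite T \<and> b \<in> gen T" for a b
  proof -
    obtain T U where T: "T \<subseteq> S" "finite T" "a \<in> gen T" and U: "U \<subseteq> S" "finite U" "b \<in> gen U"
      using ab by blast
    have "gen T \<subseteq> gen (T \<union> U)" "gen U \<subseteq> gen (T \<union> U)"
      by (rule gen_mono; use T(1) U(1) S in blast)+
    then have "a \<in> gen (T \<union> U)" "b \<in> gen (T \<union> U)" using T U by blast+
    moreover have "T \<union> U \<subseteq> S" "finite (T \<union> U)" using T U by simp_all
    ultimately show ?thesis by blast
  qed
  have "\<exists>T\<subseteq>S. finite T \<and> x \<in> gen T"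
    using assms(1)
  proof induction
    case one
    then show ?case by (intro exI[of _ "{}"]) (simp add: generate_field.one)
  next
    case (incl h)
    then show ?case by (intro exI[of _ "{h}"]) (simp add: generate_field.incl)
  next
    case (a_inv h)
    then obtain T where "T \<subseteq> S" "finite T" "h \<in> gen T" by blast
    then show ?case using generate_field.a_inv[of h R T] by blast
  next
    case (m_inv h)
    then obtain T where "T \<subseteq> S" "finite T" "h \<in> gen T" by blast
    then show ?case using generate_field.m_inv[of h R T] m_inv.hyps(2) by blast
  next
    case (eng_add h1 h2)
    obtain T where "T \<subseteq> S" "finite T" "h1 \<in> gen T" "h2 \<in> gen T"
      using join[OF eng_add.IH] by blast
    then show ?case using generate_field.eng_add[of h1 R T h2] by blast
  next
    case (eng_mult h1 h2)
    obtain T where "T \<subseteq> S" "finite T" "h1 \<in> gen T" "h2 \<in> gen T"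
      using join[OF eng_mult.IH] by blast
    then show ?case using generate_field.eng_mult[of h1 R T h2] by blast
  qed
  then show thesis using that by blast
qed

lemma subfield_nat_pow: "subfield E R \<Longrightarrow> z \<in> E \<Longrightarrow> z [^] (n::nat) \<in> E"
  by (induction n) (simp_all add: subringE(3,6)[OF subfieldE(1)])

lemma frob_pow: "x \<in> carrier R \<Longrightarrow> frob x [^] (p ^ n) = x [^] (p ^ Suc n)"
  by (simp add: nat_pow_pow)

lemma pow_frob: "x \<in> carrier R \<Longrightarrow> frob (x [^] (p ^ n)) = x [^] (p ^ Suc n)"
  by (simp add: nat_pow_pow mult.commute)

text \<open>Applying the Frobenius map to \<open>S \<subseteq> E(S\<^sup>p)\<close> repeatedly gives
  \<open>E(S) \<subseteq> E(S\<^sup>p) \<subseteq> E(S\<^bsup>p\<^sup>2\<^esup>) \<subseteq> \<dots>\<close>, and the chain ends in \<open>E\<close> if \<open>S\<close> has bounded exponent over \<open>E\<close>.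
  This is used for a whole layer, to see that its r-base generates it over the ground field,
  and for a single element.\<close>
lemma subset_gen_if_generated_by_pth_powers:
  assumes E: "E \<subseteq> carrier R" and S: "S \<subseteq> carrier R"
    and gen: "S \<subseteq> gen (E \<union> frob ` S)" and exp: "\<And>s. s \<in> S \<Longrightarrow> s [^] (p ^ n) \<in> gen E"
  shows "S \<subseteq> gen E"
proof -
  define P where "P j = (\<lambda>x. x [^] (p ^ j)) ` S" for j :: nat
  have PC: "P j \<subseteq> carrier R" for j using S by (auto simp: P_def)
  have frobP: "frob ` P j = P (Suc j)" for j
    using S by (auto simp: P_def image_image pow_frob simp del: power_Suc intro!: image_cong)
  have "P j \<subseteq> gen (E \<union> P (Suc j))" for j
  proof (induction j)
    case 0
    have "P 0 = S" using S by (force simp: P_def image_def)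
    then show ?case using gen frobP[of 0] by simp
  next
    case (Suc j)
    show ?case
    proof
      fix y assume "y \<in> P (Suc j)"
      then obtain x where x: "x \<in> P j" "y = frob x" using frobP[of j] by blast
      have "frob x \<in> gen (frob ` (E \<union> P (Suc j)))"
        using frob_gen[of "E \<union> P (Suc j)" x] Suc x(1) E PC by blast
      also have "\<dots> \<subseteq> gen (E \<union> P (Suc (Suc j)))"
      proof (rule gen_least)
        have "frob e \<in> gen (E \<union> P (Suc (Suc j)))" if "e \<in> E" for e
        proof -
          have "subfield (gen (E \<union> P (Suc (Suc j)))) R" using E PC by (intro gen_subfield) blast
          moreover have "e \<in> gen (E \<union> P (Suc (Suc j)))" using that subset_gen[of "E \<union> P (Suc (Suc j))"] by blast
          ultimately show ?thesis by (rule subfield_nat_pow)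
        qed
        then show "frob ` (E \<union> P (Suc j)) \<subseteq> gen (E \<union> P (Suc (Suc j)))"
          using frobP[of "Suc j"] subset_gen[of "E \<union> P (Suc (Suc j))"] by blast
        show "E \<union> P (Suc (Suc j)) \<subseteq> carrier R" using E PC by blast
      qed
      finally show "y \<in> gen (E \<union> P (Suc (Suc j)))" using x(2) by simp
    qed
  qed
  then have step: "gen (E \<union> P j) \<subseteq> gen (E \<union> P (Suc j))" for j
    using E PC subset_gen[of "E \<union> P (Suc j)"] by (intro gen_least) auto
  have "gen (E \<union> P 0) \<subseteq> gen (E \<union> P n)"
    by (induction n) (use step in blast)+
  moreover have "S = P 0" using S by (force simp: P_def image_def)
  moreover have "gen (E \<union> P n) \<subseteq> gen E"
    using exp E subset_gen[of E] by (intro gen_least) (auto simp: P_def)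
  ultimately show ?thesis using subset_gen[of "E \<union> P 0"] by blast
qed

lemma gen_pow:
  assumes S: "S \<subseteq> carrier R" and x: "x \<in> gen S"
  shows "x [^] (p ^ n) \<in> gen ((\<lambda>x. x [^] (p ^ n)) ` S)"
proof (induction n)
  case 0
  have "(\<lambda>x. x [^] (p ^ 0)) ` S = S" using S by (force simp: image_def)
  then show ?case using x gen_carrier[OF S] by auto
next
  case (Suc n)
  have "(\<lambda>x. x [^] (p ^ n)) ` S \<subseteq> carrier R" using S by auto
  from frob_gen[OF this Suc.IH] show ?case
    using S x gen_carrier[OF S] by (simp add: pow_frob image_image subset_iff cong: image_cong del: power_Suc)
qed

section \<open>The minimal polynomial of a p-th root\<close>

lemma coprime_powers_in_subfield:
  assumes E: "subfield E R" and z: "z \<in> carrier R" "z \<noteq> \<zero>" "z [^] a \<in> E" "z [^] b \<in> E"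
    and ab: "coprime a b" "a \<noteq> (0::nat)"
  shows "z \<in> E"
proof -
  obtain u v where uv: "a * u = b * v + 1"
    using bezout_nat[OF ab(2), of b] ab(1) by auto
  let ?y = "z [^] (b * v)"
  have y: "?y \<in> E"
    using subfield_nat_pow[OF E z(4), of v] nat_pow_pow[OF z(1), of b v] by simp
  have w: "z [^] (a * u) \<in> E"
    using subfield_nat_pow[OF E z(3), of u] nat_pow_pow[OF z(1), of a u] by simp
  have "z \<in> Units R"
    using z field_Units by blast
  then have yU: "?y \<in> Units R"
    by (rule Units_pow_closed)
  then have "?y \<noteq> \<zero>"
    using field_Units by blast
  then have "inv ?y \<in> E"
    using subfield_m_inv(1)[OF E] y by blast
  then have "inv ?y \<otimes> z [^] (a * u) \<in> E"
    using subringE(6)[OF subfieldE(1)[OF E]] w by blast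
  moreover have "z [^] (a * u) = ?y \<otimes> z"
    using z(1) by (simp add: uv)
  then have "inv ?y \<otimes> z [^] (a * u) = z"
    using yU z(1) by (simp add: m_assoc[symmetric])
  ultimately show ?thesis by simp
qed

lemma linear_polynomial_frob:
  assumes c: "c \<in> carrier R" "c \<noteq> \<zero>"
  shows "[\<one>, c] [^]\<^bsub>poly_ring R\<^esub> p = X [^]\<^bsub>poly_ring R\<^esub> p \<oplus>\<^bsub>poly_ring R\<^esub> [frob c]"
proof -
  interpret U: domain "poly_ring R"
    using univ_poly_is_domain[OF carrier_is_subring] .
  interpret h: ring_hom_ring R "poly_ring R" poly_of_const
    using canonical_embedding_ring_hom[OF carrier_is_subring] by simp
  have "poly_of_const (add_pow R n \<one>) = add_pow (poly_ring R) n \<one>\<^bsub>poly_ring R\<^esub>" for n :: nat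
    by (induction n) (simp_all add: h.hom_add)
  from this[of p] have ch: "add_pow (poly_ring R) p \<one>\<^bsub>poly_ring R\<^esub> = \<zero>\<^bsub>poly_ring R\<^esub>"
    using p_one by simp
  have P: "[\<one>, c] = X \<oplus>\<^bsub>poly_ring R\<^esub> [c]"
    using c by (simp add: univ_poly_add var_def)
  have C: "[c] \<in> carrier (poly_ring R)"
    using c unfolding univ_poly_carrier[symmetric] polynomial_def by auto
  have "frob c \<noteq> \<zero>"
    using c Units_pow_closed[of c p] field_Units by simp
  then have "[c] [^]\<^bsub>poly_ring R\<^esub> p = [frob c]"
    using h.hom_nat_pow[of c p] c by (simp add: poly_of_const_def)
  then show ?thesis
    unfolding P using U.power_char_add[OF prime_char ch var_closed(1)[OF carrier_is_subring] C] by simp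
qed

text \<open>The minimal polynomial divides \<open>X\<^sup>p - x\<^sup>p = (X - x)\<^sup>p\<close>, so it is \<open>(X - x)\<^sup>j\<close> with \<open>1 \<le> j \<le> p\<close>.
  Its constant term shows that \<open>(-x)\<^sup>j\<close> lies in \<open>E\<close>, as does \<open>(-x)\<^sup>p\<close>. For \<open>j < p\<close> the exponents
  are coprime, and \<open>x\<close> itself would lie in \<open>E\<close>.\<close>
lemma degree_Irr_pth_root:
  assumes E: "subfield E R" and x: "x \<in> carrier R" "frob x \<in> E" "x \<notin> E"
  shows "(algebraic over E) x" and "degree (Irr E x) = p"
proof -
  let ?P = "[\<one>, \<ominus> x]" and ?R = "poly_ring R"
  let ?f = "?P [^]\<^bsub>?R\<^esub> p"
  note Esub = subfieldE(1)[OF E]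
  interpret UE: domain "E[X]"
    using univ_poly_is_domain[OF Esub] .
  have x0: "x \<noteq> \<zero>" using x(3) subringE(2)[OF Esub] by blast
  then have mx: "\<ominus> x \<noteq> \<zero>" "\<ominus> x \<in> carrier R" using x(1) by simp_all
  have P: "?P \<in> carrier ?R"
    using x unfolding univ_poly_carrier[symmetric] polynomial_def by auto
  have fmx: "frob (\<ominus> x) \<in> E"
    using x subringE(5)[OF Esub] by (simp add: frob_uminus)
  have fmx0: "frob (\<ominus> x) \<noteq> \<zero>"
    using mx Units_pow_closed[of "\<ominus> x" p] field_Units by simp
  \<comment> \<open>Expanded by the Frobenius map, \<open>(X - x)\<^sup>p\<close> is seen to have its coefficients in \<open>E\<close>.\<close>
  have "X [^]\<^bsub>E[X]\<^esub> p \<oplus>\<^bsub>E[X]\<^esub> [frob (\<ominus> x)] \<in> carrier (E[X])"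
    using var_pow_closed[OF Esub] fmx fmx0
    by (intro UE.a_closed) (auto simp: univ_poly_carrier[symmetric] polynomial_def)
  moreover have "X [^]\<^bsub>E[X]\<^esub> p \<oplus>\<^bsub>E[X]\<^esub> [frob (\<ominus> x)] = ?f"
    unfolding linear_polynomial_frob[OF mx(2,1)] univ_poly_add
    by (simp add: unitary_monom_eq_var_pow[OF Esub, symmetric]
        unitary_monom_eq_var_pow[OF carrier_is_subring, symmetric])
  ultimately have f: "?f \<in> carrier (E[X])" by simp
  have f0: "?f \<noteq> []"
    using polynomial_pow_not_zero[OF P] by simp
  interpret ev: ring_hom_ring "poly_ring R" R "\<lambda>q. eval q x"
    using eval_ring_hom[OF carrier_is_subring x(1)] .
  have "eval ?P x = \<zero>" using x by (simp add: r_neg)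
  then have fx: "eval ?f x = \<zero>"
    using ev.hom_nat_pow[OF P, of p] frob_zero by simp
  show alg: "(algebraic over E) x"
    using algebraicI[OF f f0 fx] .
  note I = IrrE[OF E x(1) alg]
  have IR: "Irr E x \<in> carrier ?R"
    using carrier_polynomial_shell[OF Esub I(1)] .
  obtain h where "h \<in> carrier ?R" "?f = Irr E x \<otimes>\<^bsub>?R\<^esub> h"
    using Irr_minimal[OF E x(1) alg f fx] by (auto simp: pdivides_def factor_def)
  then obtain j where j: "j \<le> p" "Irr E x = ?P [^]\<^bsub>?R\<^esub> j"
    using monic_divisor_of_linear_power[OF mx(2) IR, of h p] I(3) by auto
  have deg: "degree (Irr E x) = j"
    using polynomial_pow_degree[OF P, of j] j(2) by simp
  interpret ev0: ring_hom_ring "poly_ring R" R "\<lambda>q. eval q \<zero>"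
    using eval_ring_hom[OF carrier_is_subring] by simp
  have "eval (Irr E x) \<zero> = (\<ominus> x) [^] j"
    using ev0.hom_nat_pow[OF P, of j] x j(2) by simp
  moreover have "eval (Irr E x) \<zero> \<in> E"
    using const_term_simprules_shell(1)[OF Esub I(1)] unfolding const_term_def .
  ultimately have mxj: "(\<ominus> x) [^] j \<in> E" by simp
  have "j \<noteq> 0"
  proof
    assume "j = 0"
    then have "Irr E x = [\<one>]"
      using j(2) by (simp add: univ_poly_one)
    then show False
      using I(4) by simp
  qed
  moreover have "\<ominus> x \<notin> E"
    using x subringE(5)[OF Esub, of "\<ominus> x"] by auto
  then have "\<not> coprime p j"
    using coprime_powers_in_subfield[OF E mx(2,1) fmx mxj] char_pos by blast
  then have "p dvd j"
    using prime_char prime_imp_coprime by blast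
  ultimately show "degree (Irr E x) = p"
    using j(1) deg by (auto dest: dvd_imp_le)
qed

section \<open>The exchange property\<close>

lemma pth_root_extension_polynomial:
  assumes E: "subfield E R" and x: "x \<in> carrier R" "frob x \<in> E" "x \<notin> E"
    and y: "y \<in> gen (insert x E)"
  obtains q where "q \<in> carrier (E[X])" "q = [] \<or> degree q < p" "eval q x = y"
proof -
  have EC: "E \<subseteq> carrier R" using subfieldE(3)[OF E] .
  note alg = degree_Irr_pth_root[OF E x]
  note I = IrrE[OF E x(1) alg(1)]
  have "subfield (simple_extension E x) R"
    using simple_extension_is_subfield[OF E x(1)] alg(1) by simp
  moreover have "insert x E \<subseteq> simple_extension E x"
    using simple_extension_incl[OF EC x(1)] simple_extension_mem[OF subfieldE(1)[OF E] x(1)] by simp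
  ultimately have "gen (insert x E) \<subseteq> simple_extension E x"
    using EC x(1) by (intro generate_field_min_subfield1) auto
  then obtain f where f: "f \<in> carrier (E[X])" "eval f x = y"
    using y simple_extension_as_eval_img[OF EC x(1)] by auto
  interpret ev: ring_hom_ring "E[X]" R "\<lambda>q. eval q x"
    using eval_ring_hom[OF subfieldE(1)[OF E] x(1)] .
  let ?g = "Irr E x"
  have g0: "?g \<noteq> []" using alg(2) char_pos by auto
  note c = long_division_closed[OF E f(1) I(1)]
  have "eval f x = eval ?g x \<otimes> eval (f pdiv ?g) x \<oplus> eval (f pmod ?g) x"
    using pdiv_pmod[OF E f(1) I(1)] c I(1) ev.hom_add ev.hom_mult ev.R.m_closed by metis
  also have "\<dots> = eval (f pmod ?g) x"
    using I(4) ev.hom_closed[OF c(1)] ev.hom_closed[OF c(2)] by simp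
  finally have "eval (f pmod ?g) x = y" using f(2) by simp
  moreover have "f pmod ?g = [] \<or> degree (f pmod ?g) < p"
    using pmod_degree[OF E f(1) I(1) g0] alg(2) by simp
  ultimately show thesis using that c(2) by blast
qed

text \<open>Write \<open>y = q(x)\<close> with \<open>q\<close> of degree below \<open>p\<close> over \<open>F\<close>. If \<open>x\<close> were not in \<open>F(y)\<close>, its minimal
  polynomial over \<open>F(y)\<close> would have degree \<open>p\<close> and divide \<open>q - y\<close>; then \<open>q\<close> is the constant \<open>y\<close>,
  and \<open>y \<in> F\<close>.\<close>
lemma pth_root_exchange:
  assumes F: "F \<subseteq> carrier R" and x: "x \<in> carrier R" "frob x \<in> gen F"
    and y: "y \<in> gen (insert x F)" "y \<notin> gen F"
  shows "x \<in> gen (insert y F)"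
proof (rule ccontr)
  let ?E = "gen (insert y F)"
  assume xE: "x \<notin> ?E"
  have yc: "y \<in> carrier R" using y(1) F x(1) gen_carrier[of "insert x F"] by blast
  have sub: "subfield (gen F) R" "subfield ?E R"
    using F yc by (auto intro: gen_subfield)
  have FE: "gen F \<subseteq> ?E" using F yc by (intro gen_mono) auto
  have xF: "x \<notin> gen F" using FE xE by blast
  have "y \<in> gen (insert x (gen F))"
    using y(1) gen_mono[of "insert x F" "insert x (gen F)"] subset_gen[of F] gen_carrier[OF F] x(1)
    by blast
  then obtain q where q: "q \<in> carrier ((gen F)[X])" "q = [] \<or> degree q < p" "eval q x = y"
    using pth_root_extension_polynomial[OF sub(1) x xF] by blast
  have qE: "q \<in> carrier (?E[X])"
    using q(1) FE unfolding univ_poly_carrier[symmetric] polynomial_def by blast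
  have y0: "y \<noteq> \<zero>" using y(2) zero_in_generate by blast
  have yE: "y \<in> ?E" using subset_gen[of "insert y F"] by simp
  have cy: "[y] \<in> carrier (?E[X])"
    using y0 yE unfolding univ_poly_carrier[symmetric] polynomial_def by simp
  have xE': "frob x \<in> ?E" using x(2) FE by blast
  note alg = degree_Irr_pth_root[OF sub(2) x(1) xE' xE]
  note I = IrrE[OF sub(2) x(1) alg(1)]
  interpret ev: ring_hom_ring "?E[X]" R "\<lambda>q. eval q x"
    using eval_ring_hom[OF subfieldE(1)[OF sub(2)] x(1)] .
  have "eval (q \<ominus>\<^bsub>?E[X]\<^esub> [y]) x = eval q x \<ominus> eval [y] x"
    unfolding a_minus_def using qE cy by (simp del: eval.simps)
  also have "\<dots> = \<zero>" using q(3) yc by (simp add: r_neg a_minus_def)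
  finally have "Irr ?E x pdivides (q \<ominus>\<^bsub>?E[X]\<^esub> [y])"
    using qE cy by (intro Irr_minimal[OF sub(2) x(1) alg(1)]) auto
  then have "q pmod Irr ?E x = [y] pmod Irr ?E x"
    using same_pmod_iff_pdivides[OF sub(2) qE cy I(1)] by simp
  moreover have "q pmod Irr ?E x = q"
    using q(2) alg(2) char_pos by (intro pmod_const[OF sub(2) qE I(1)]) auto
  moreover have "[y] pmod Irr ?E x = [y]"
    using alg(2) char_pos by (intro pmod_const[OF sub(2) cy I(1)]) auto
  ultimately have "q = [y]" by simp
  then have "y \<in> gen F"
    using q(1) unfolding univ_poly_carrier[symmetric] polynomial_def by simp
  then show False using y(2) by blast
qed

section \<open>Independence and the existence of r-bases\<close>

text \<open>With \<open>F\<close> generating \<open>k(K\<^sup>p)\<close> this is the minimality condition in the definition of an r-base of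
  \<open>K/k\<close>. As \<open>F\<close> only matters through the field that it generates, arbitrary sets are allowed.\<close>
definition indep :: "'a set \<Rightarrow> 'a set \<Rightarrow> bool" where
  "indep F Y \<longleftrightarrow> (\<forall>x\<in>Y. x \<notin> gen (F \<union> (Y - {x})))"

lemma indep_mono:
  assumes "indep F Y" "E \<subseteq> F" "Z \<subseteq> Y" "F \<subseteq> carrier R" "Y \<subseteq> carrier R"
  shows "indep E Z"
  unfolding indep_def
proof
  fix y assume "y \<in> Z"
  moreover have "gen (E \<union> (Z - {y})) \<subseteq> gen (F \<union> (Y - {y}))"
    using assms by (intro gen_mono) auto
  ultimately show "y \<notin> gen (E \<union> (Z - {y}))"
    using assms unfolding indep_def by blast
qed

text \<open>A dependence of some \<open>y \<in> Y\<close> on \<open>x\<close> and the rest of \<open>Y\<close> would, by exchange, put \<open>x\<close> into the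
  span of \<open>Y\<close>.\<close>
lemma indep_insert:
  assumes F: "F \<subseteq> carrier R" and Y: "Y \<subseteq> carrier R" "indep F Y"
    and x: "x \<in> carrier R" "frob x \<in> gen F" "x \<notin> gen (F \<union> Y)"
  shows "indep F (insert x Y)"
  unfolding indep_def
proof
  fix y assume y: "y \<in> insert x Y"
  have xX: "x \<notin> Y" using x(3) subset_gen[of "F \<union> Y"] by blast
  show "y \<notin> gen (F \<union> (insert x Y - {y}))"
  proof (cases "y = x")
    case True
    then show ?thesis using x(3) xX by simp
  next
    case False
    then have yX: "y \<in> Y" using y by simp
    define G where "G = F \<union> (Y - {y})"
    have G: "G \<subseteq> carrier R" using F Y by (auto simp: G_def)
    have e: "F \<union> (insert x Y - {y}) = insert x G" "insert y G = F \<union> Y"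
      using False yX by (auto simp: G_def)
    have "y \<notin> gen G" using Y(2) yX by (auto simp: indep_def G_def)
    moreover have "frob x \<in> gen G" using x(2) gen_mono[of F G] G by (auto simp: G_def)
    ultimately have "y \<notin> gen (insert x G)"
      using pth_root_exchange[OF G x(1)] x(3) e(2) by metis
    then show ?thesis using e(1) by simp
  qed
qed

text \<open>By exchange, an element outside the span can be added to an independent set, so a maximal
  independent set is spanning. Finitary generation makes Zorn's lemma applicable.\<close>
lemma indep_spanning_exists:
  assumes K: "subfield K R" and F: "F \<subseteq> K" "frob ` K \<subseteq> gen F"
  obtains B where "B \<subseteq> K" "gen (F \<union> B) = K" "indep F B"
proof -
  have KC: "K \<subseteq> carrier R" using subfieldE(3)[OF K] .
  define A where "A = {B. B \<subseteq> K \<and> indep F B}"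
  have "\<exists>M\<in>A. \<forall>Y\<in>A. M \<subseteq> Y \<longrightarrow> Y = M"
  proof (rule subset_Zorn_nonempty)
    show "A \<noteq> {}" by (auto simp: A_def indep_def)
    fix C assume C: "C \<noteq> {}" "subset.chain A C"
    have CK: "\<Union>C \<subseteq> K" using C by (auto simp: subset_chain_def A_def)
    have "x \<notin> gen (F \<union> (\<Union>C - {x}))" if x: "x \<in> \<Union>C" for x
    proof
      assume "x \<in> gen (F \<union> (\<Union>C - {x}))"
      moreover have "F \<union> (\<Union>C - {x}) \<subseteq> carrier R"
        using CK F(1) KC by blast
      ultimately obtain T where T: "T \<subseteq> F \<union> (\<Union>C - {x})" "finite T" "x \<in> gen T"
        by (rule gen_finitary)
      have "finite (insert x (T - F))" "insert x (T - F) \<subseteq> \<Union>C"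
        using T x by auto
      then obtain B where B: "B \<in> C" "insert x (T - F) \<subseteq> B"
        using finite_subset_Union_chain[OF _ _ C] by blast
      have "B \<in> A" using B C by (auto simp: subset_chain_def)
      then have "indep F B" "B \<subseteq> K" by (auto simp: A_def)
      moreover have "gen T \<subseteq> gen (F \<union> (B - {x}))"
        using B T F KC \<open>B \<subseteq> K\<close> by (intro gen_mono) auto
      ultimately show False using B T(3) by (auto simp: indep_def)
    qed
    then show "\<Union>C \<in> A" using CK by (auto simp: A_def indep_def)
  qed
  then obtain B where "B \<in> A" and max: "\<forall>Y\<in>A. B \<subseteq> Y \<longrightarrow> Y = B" by blast
  then have B: "B \<subseteq> K" "indep F B" by (auto simp: A_def)
  have "K \<subseteq> gen (F \<union> B)"
  proof
    fix x assume x: "x \<in> K"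
    show "x \<in> gen (F \<union> B)"
    proof (rule ccontr)
      assume n: "x \<notin> gen (F \<union> B)"
      then have "indep F (insert x B)"
        using x F B KC by (intro indep_insert) blast+
      then have "insert x B \<in> A" using x B(1) by (simp add: A_def)
      then have "insert x B = B" using max by blast
      then show False using n subset_gen[of "F \<union> B"] by blast
    qed
  qed
  moreover have "gen (F \<union> B) \<subseteq> K"
    using F(1) B(1) KC by (intro generate_field_min_subfield1[OF _ K]) auto
  ultimately have "gen (F \<union> B) = K" by blast
  then show thesis using that B by blast
qed

section \<open>Independent sets in finitely generated extensions\<close>

text \<open>If \<open>Y\<close> becomes dependent, some \<open>x \<in> Y\<close> lies in \<open>E(t)(Y - {x})\<close> but not in \<open>E(Y - {x})\<close>. Then
  \<open>t\<close> is not in \<open>E(Y - {x})\<close> either, and removing \<open>x\<close> suffices: by exchange, any further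
  dependence would put \<open>t\<close> into \<open>E(Y - {x})\<close>.\<close>
lemma indep_adjoin_pth_root:
  assumes E: "E \<subseteq> carrier R" and Y: "Y \<subseteq> carrier R" "indep E Y"
    and t: "t \<in> carrier R" "frob t \<in> gen E"
  shows "\<exists>x. indep (insert t E) (Y - {x})"
proof (cases "indep (insert t E) Y")
  case True
  then show ?thesis using E Y t indep_mono[OF True order_refl, of "Y - {x}" for x] by blast
next
  case False
  then obtain x where x: "x \<in> Y" "x \<in> gen (insert t (E \<union> (Y - {x})))"
    by (auto simp: indep_def)
  have frob_t: "frob t \<in> gen (E \<union> Z)" if "Z \<subseteq> Y" for Z
    using t(2) gen_mono[of E "E \<union> Z"] that E Y(1) by blast
  have x': "x \<notin> gen (E \<union> (Y - {x}))" using x(1) Y(2) by (simp add: indep_def)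
  have C: "E \<union> (Y - {x}) \<subseteq> carrier R" using E Y by blast
  have tn: "t \<notin> gen (E \<union> (Y - {x}))"
    using gen_insert_absorb[OF _ C] x(2) x' by blast
  have "y \<notin> gen (insert t E \<union> (Y - {x} - {y}))" if y: "y \<in> Y - {x}" for y
  proof
    let ?G = "E \<union> (Y - {x} - {y})"
    assume "y \<in> gen (insert t E \<union> (Y - {x} - {y}))"
    then have yt: "y \<in> gen (insert t ?G)" by simp
    have G: "?G \<subseteq> carrier R" using E Y by blast
    have "indep E (Y - {x})" using indep_mono[OF Y(2), of E "Y - {x}"] E Y(1) by blast
    then have yG: "y \<notin> gen ?G" using y by (simp add: indep_def)
    have fG: "frob t \<in> gen ?G" by (rule frob_t) blast
    have "t \<in> gen (insert y ?G)" by (rule pth_root_exchange[OF G t(1) fG yt yG])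
    moreover have "insert y ?G = E \<union> (Y - {x})" using y by blast
    ultimately show False using tn by simp
  qed
  then show ?thesis by (auto simp: indep_def)
qed

text \<open>The tower \<open>E \<subseteq> E(t\<^sup>p) \<subseteq> E(t)\<close> is climbed from below. It has up to \<open>n\<close> steps of degree \<open>p\<close>, yet only
  one element is lost: if \<open>s = t\<^sup>p\<close> is not in \<open>E\<close>, then the second step costs nothing. For a new
  dependence gives \<open>t \<in> E(s)(Y)\<close> by exchange, and taking \<open>p\<close>-th powers with \<open>Y\<^sup>p \<subseteq> E\<close> gives
  \<open>s \<in> E(s\<^sup>p)\<close>, whence \<open>s \<in> E\<close> as \<open>s\<close> is purely inseparable over \<open>E\<close>.\<close>
lemma indep_adjoin:
  assumes E: "E \<subseteq> carrier R" and Y: "Y \<subseteq> carrier R" "indep E Y" "frob ` Y \<subseteq> gen E"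
    and t: "t \<in> carrier R" "t [^] (p ^ n) \<in> gen E"
  shows "\<exists>x. indep (insert t E) (Y - {x})"
  using t
proof (induction n arbitrary: t)
  case 0
  then have "frob t \<in> gen E"
    using subfield_nat_pow[OF gen_subfield[OF E]] by simp
  then show ?case using indep_adjoin_pth_root[OF E Y(1,2) 0(1)] by blast
next
  case (Suc n)
  let ?s = "frob t"
  show ?case
  proof (cases "?s \<in> gen E")
    case True
    then show ?thesis using indep_adjoin_pth_root[OF E Y(1,2) Suc.prems(1)] by blast
  next
    case False
    have s: "?s \<in> carrier R" "?s [^] (p ^ n) \<in> gen E"
      using Suc.prems frob_pow by simp_all
    then obtain x where x: "indep (insert ?s E) (Y - {x})"
      using Suc.IH by blast
    have "y \<notin> gen (insert t E \<union> (Y - {x} - {y}))" if y: "y \<in> Y - {x}" for y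
    proof
      let ?G = "insert ?s E \<union> (Y - {x} - {y})"
      assume y': "y \<in> gen (insert t E \<union> (Y - {x} - {y}))"
      have G: "?G \<subseteq> carrier R" using E Y(1) s(1) by blast
      have "gen (insert t E \<union> (Y - {x} - {y})) \<subseteq> gen (insert t ?G)"
        using G Suc.prems(1) by (intro gen_mono) auto
      then have yt: "y \<in> gen (insert t ?G)" using y' by blast
      have yG: "y \<notin> gen ?G" using x y by (simp add: indep_def)
      have fG: "frob t \<in> gen ?G" using subset_gen[of ?G] by blast
      have "t \<in> gen (insert y ?G)" by (rule pth_root_exchange[OF G Suc.prems(1) fG yt yG])
      moreover have "insert y ?G = insert ?s E \<union> (Y - {x})" using y by blast
      ultimately have "t \<in> gen (insert ?s E \<union> (Y - {x}))" by simp
      then have "?s \<in> gen (frob ` (insert ?s E \<union> (Y - {x})))"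
        using frob_gen[of "insert ?s E \<union> (Y - {x})" t] E Y(1) s(1) by blast
      also have "\<dots> \<subseteq> gen (E \<union> frob ` {?s})"
      proof (rule gen_least)
        have C: "E \<union> frob ` {?s} \<subseteq> carrier R" using E s(1) by simp
        then have sub: "subfield (gen (E \<union> frob ` {?s})) R" by (rule gen_subfield)
        have EG: "gen E \<subseteq> gen (E \<union> frob ` {?s})" using C by (intro gen_mono) auto
        have "frob e \<in> gen (E \<union> frob ` {?s})" if "e \<in> E" for e
          using subfield_nat_pow[OF sub] that subset_gen[of "E \<union> frob ` {?s}"] by blast
        moreover have "frob ?s \<in> gen (E \<union> frob ` {?s})"
          using subset_gen[of "E \<union> frob ` {?s}"] by blast
        ultimately show "frob ` (insert ?s E \<union> (Y - {x})) \<subseteq> gen (E \<union> frob ` {?s})"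
          using Y(3) EG by blast
        show "E \<union> frob ` {?s} \<subseteq> carrier R" by (rule C)
      qed
      finally have "{?s} \<subseteq> gen E"
        using subset_gen_if_generated_by_pth_powers[OF E, of "{?s}" n] s by blast
      then show False using False by blast
    qed
    then show ?thesis by (auto simp: indep_def)
  qed
qed

text \<open>The ground field varies in the induction on \<open>T\<close>: \<open>t\<close> moves from the generators into \<open>k\<close>, at
  the cost of one element of \<open>Y\<close>. Independence over \<open>k(Y\<^sup>p)(t)\<close> then restricts to the smaller field
  generated by \<open>k(t)\<close> and the \<open>p\<close>-th powers of the remaining elements.\<close>
lemma card_le_card_generators:
  assumes "finite T" "T \<subseteq> carrier R" "k \<subseteq> carrier R" "\<And>t. t \<in> T \<Longrightarrow> \<exists>n. t [^] (p ^ n) \<in> gen k"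
    and "Y \<subseteq> gen (k \<union> T)" "indep (k \<union> frob ` Y) Y"
  shows "finite Y \<and> card Y \<le> card T"
  using assms
proof (induction T arbitrary: k Y)
  case empty
  have "y \<notin> Y" for y
  proof
    assume y: "y \<in> Y"
    have "Y \<subseteq> carrier R" using empty gen_carrier[of k] by auto
    then have "gen k \<subseteq> gen (k \<union> frob ` Y \<union> (Y - {y}))"
      using empty(2) by (intro gen_mono) auto
    then show False using y empty(4,5) by (auto simp: indep_def)
  qed
  then have "Y = {}" by blast
  then show ?case by simp
next
  case (insert t T)
  have C: "k \<union> insert t T \<subseteq> carrier R" using insert.prems by blast
  then have YC: "Y \<subseteq> carrier R" using insert.prems(4) gen_carrier by blast
  let ?E = "k \<union> frob ` Y"
  have EC: "?E \<subseteq> carrier R" using YC C by auto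
  obtain n where "t [^] (p ^ n) \<in> gen k" using insert.prems(3) by blast
  moreover have "gen k \<subseteq> gen ?E" using EC by (intro gen_mono) auto
  ultimately have tn: "t [^] (p ^ n) \<in> gen ?E" by blast
  have fY: "frob ` Y \<subseteq> gen ?E" using subset_gen[of ?E] by blast
  obtain x where x: "indep (insert t ?E) (Y - {x})"
    using indep_adjoin[OF EC YC insert.prems(5) fY _ tn] C by blast
  let ?Z = "Y - {x}" and ?k = "insert t k"
  have "indep (?k \<union> frob ` ?Z) ?Z"
    using indep_mono[OF x, of "?k \<union> frob ` ?Z" ?Z] EC YC C by blast
  moreover have "?Z \<subseteq> gen (?k \<union> T)" using insert.prems(4) by auto
  moreover have "\<exists>n. u [^] (p ^ n) \<in> gen ?k" if "u \<in> T" for u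
    using insert.prems(3)[of u] that gen_mono[of k ?k] C by blast
  ultimately have "finite ?Z \<and> card ?Z \<le> card T"
    using insert.IH[of ?k ?Z] C by blast
  then have "finite Y" "card Y \<le> Suc (card T)"
    by (auto simp: card_Diff_singleton_if split: if_splits)
  then show ?case using insert.hyps by simp
qed

section \<open>Root layers and their r-bases\<close>

text \<open>The map \<open>x \<mapsto> x^(p^n)\<close> sends the field generated by the layer into the one generated by the
  image of the layer, which lies in \<open>k\<close>; so the generated field is the layer itself.\<close>
lemma root_layer_subfield:
  assumes k: "subfield k R" and K: "subfield K R"
  shows "subfield (root_layer R p K k n) R"
proof -
  let ?L = "root_layer R p K k n"
  have LC: "?L \<subseteq> carrier R" and LK: "?L \<subseteq> K"
    using subfieldE(3)[OF K] by (auto simp: root_layer_def)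
  have "gen ?L \<subseteq> ?L"
  proof
    fix x assume x: "x \<in> gen ?L"
    have "gen ?L \<subseteq> K" by (rule generate_field_min_subfield1[OF LC K LK])
    moreover have "gen ((\<lambda>x. x [^] (p ^ n)) ` ?L) \<subseteq> k"
      by (rule generate_field_min_subfield1[OF _ k]) (use LC in \<open>auto simp: root_layer_def\<close>)
    ultimately show "x \<in> ?L"
      using x gen_pow[OF LC x, of n] by (auto simp: root_layer_def)
  qed
  then have "gen ?L = ?L" using subset_gen[of ?L] by blast
  then show ?thesis using gen_subfield[OF LC] by simp
qed

lemma root_layer_mono:
  assumes k: "subfield k R" and K: "subfield K R" and "i \<le> j"
  shows "root_layer R p K k i \<subseteq> root_layer R p K k j"
proof
  fix x assume x: "x \<in> root_layer R p K k i"
  then have "x \<in> carrier R" "x [^] (p ^ i) \<in> k" using subfieldE(3)[OF K] by (auto simp: root_layer_def)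
  then have "x [^] (p ^ i * p ^ (j - i)) \<in> k"
    using subfield_nat_pow[OF k, of _ "p ^ (j - i)"] by (simp add: nat_pow_pow[symmetric])
  moreover have "p ^ i * p ^ (j - i) = p ^ j" using assms(3) by (simp add: power_add[symmetric])
  ultimately show "x \<in> root_layer R p K k j" using x by (simp add: root_layer_def)
qed

lemma r_base_iff:
  "r_base R p K k B \<longleftrightarrow>
    B \<subseteq> K \<and> K = gen (gen (k \<union> frob ` K) \<union> B) \<and> indep (gen (k \<union> frob ` K)) B"
  unfolding r_base_def adjoin_def pth_powers_def indep_def ..

lemma r_base_exists:
  assumes k: "subfield k R" and K: "subfield K R" and "k \<subseteq> K"
  shows "\<exists>B. r_base R p K k B"
proof -
  let ?F = "gen (k \<union> frob ` K)"
  have KC: "K \<subseteq> carrier R" using subfieldE(3)[OF K] .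
  have "k \<union> frob ` K \<subseteq> K" using assms subfield_nat_pow[OF K] by auto
  then have "?F \<subseteq> K" using KC by (intro generate_field_min_subfield1[OF _ K]) auto
  moreover have "frob ` K \<subseteq> gen ?F"
    using subset_gen[of "k \<union> frob ` K"] subset_gen[of ?F] by blast
  ultimately obtain B where "B \<subseteq> K" "gen (?F \<union> B) = K" "indep ?F B"
    by (rule indep_spanning_exists[OF K])
  then show ?thesis unfolding r_base_iff by blast
qed

lemma r_base_generates:
  assumes k: "k \<subseteq> K" and K: "K \<subseteq> carrier R" and B: "r_base R p K k B"
    and exp: "\<And>x. x \<in> K \<Longrightarrow> x [^] (p ^ n) \<in> k"
  shows "K \<subseteq> gen (k \<union> B)"
proof (rule subset_gen_if_generated_by_pth_powers)
  have BK: "B \<subseteq> K" and Kg: "K = gen (gen (k \<union> frob ` K) \<union> B)"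
    using B unfolding r_base_iff by blast+
  show C: "k \<union> B \<subseteq> carrier R" using BK k K by blast
  have C': "k \<union> B \<union> frob ` K \<subseteq> carrier R" using C K by auto
  have "gen (k \<union> frob ` K) \<subseteq> gen (k \<union> B \<union> frob ` K)"
    using C' by (intro gen_mono) auto
  then have "gen (gen (k \<union> frob ` K) \<union> B) \<subseteq> gen (k \<union> B \<union> frob ` K)"
    using C' subset_gen[of "k \<union> B \<union> frob ` K"] by (intro gen_least) auto
  then show "K \<subseteq> gen (k \<union> B \<union> frob ` K)" using Kg by simp
  show "x [^] (p ^ n) \<in> gen (k \<union> B)" if "x \<in> K" for x
    using exp[OF that] subset_gen[of "k \<union> B"] by blast
qed (rule K)

section \<open>Monotonicity of the degree of irrationality\<close>

text \<open>The use of \<open>Suc\<close> in \<open>la\<close> below makes the layers start with exponent \<open>1\<close>, as in the definition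
  of \<open>di\<close>. The set \<open>B\<close> is an r-base of an arbitrary extension \<open>M/L\<close> between \<open>k\<close> and \<open>K\<close>, but it
  enters only through its independence over \<open>k(B\<^sup>p)\<close>.\<close>
lemma card_r_base_le_di:
  assumes fields: "subfield k R" "subfield K R" and kK: "k \<subseteq> K"
    and pi: "purely_inseparable R p K k"
    and L: "k \<subseteq> L" "L \<subseteq> K" and M: "M \<subseteq> K" and B: "r_base R p M L B"
  shows "|B| \<le>o di R p K k"
proof -
  have KC: "K \<subseteq> carrier R" using subfieldE(3)[OF fields(2)] .
  define la where "la m = root_layer R p K k (Suc m)" for m
  have la: "subfield (la m) R" "k \<subseteq> la m" "la m \<subseteq> K" for m
    using root_layer_subfield[OF fields] kK subfield_nat_pow[OF fields(1)]
    by (auto simp: la_def root_layer_def simp del: power_Suc)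
  have "\<forall>m. \<exists>C. r_base R p (la m) k C"
    using r_base_exists[OF fields(1) la(1,2)] by blast
  then obtain C where C: "\<And>m. r_base R p (la m) k (C m)" by metis
  have Cla: "C m \<subseteq> la m" for m using C[of m] by (simp add: r_base_iff)
  have genC: "la m \<subseteq> gen (k \<union> C m)" for m
  proof (rule r_base_generates[OF la(2) _ C])
    show "la m \<subseteq> carrier R" using la(3) KC by blast
    show "x [^] (p ^ Suc m) \<in> k" if "x \<in> la m" for x
      using that by (simp add: la_def root_layer_def)
  qed
  have BM: "B \<subseteq> M" and indepB: "indep (gen (L \<union> frob ` M)) B"
    using B unfolding r_base_iff by blast+
  have BC: "B \<subseteq> carrier R" using BM M KC by blast
  have FC: "L \<union> frob ` M \<subseteq> carrier R" using L M KC by auto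
  have kB: "k \<union> frob ` B \<subseteq> gen (L \<union> frob ` M)"
    using subset_gen[of "L \<union> frob ` M"] L(1) BM by blast
  have iB: "indep (k \<union> frob ` B) B"
    using indep_mono[OF indepB kB order_refl gen_carrier[OF FC] BC] .
  show ?thesis
  proof (rule ordLeq_bounded_finite_pieces)
    show "Card_order (di R p K k)" by (rule Card_order_di)
    show "|C m| \<le>o di R p K k" for m
      using r_base_ordLeq_di[OF _ C[of m, unfolded la_def]] by simp
    show "finite (B \<inter> gen (k \<union> T)) \<and> card (B \<inter> gen (k \<union> T)) \<le> card T"
      if T: "T \<subseteq> (\<Union>m. C m)" "finite T" for T
    proof (rule card_le_card_generators[OF T(2)])
      have TK: "T \<subseteq> K" using T(1) Cla la(3) by blast
      then show "T \<subseteq> carrier R" using KC by blast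
      show "k \<subseteq> carrier R" using kK KC by blast
      show "\<exists>n. t [^] (p ^ n) \<in> gen k" if "t \<in> T" for t
        using pi that TK gen_subfield_eq[OF fields(1)] unfolding purely_inseparable_def by auto
      show "indep (k \<union> frob ` (B \<inter> gen (k \<union> T))) (B \<inter> gen (k \<union> T))"
      proof (rule indep_mono[OF iB])
        show "k \<union> frob ` B \<subseteq> carrier R" using kK KC BC by auto
      qed (use BC in auto)
    qed auto
    show "\<exists>m T. T \<subseteq> C m \<and> finite T \<and> Z \<subseteq> gen (k \<union> T)" if Z: "Z \<subseteq> B" "finite Z" for Z
    proof -
      have "\<exists>m. Z \<subseteq> la m"
        using Z(2,1)
      proof induction
        case (insert z Z)
        then obtain m where m: "Z \<subseteq> la m" by blast
        have zK: "z \<in> K" using insert.prems BM M by blast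
        then obtain n where "z [^] (p ^ n) \<in> k" using pi by (auto simp: purely_inseparable_def)
        then have "z \<in> root_layer R p K k n" using zK by (simp add: root_layer_def)
        then have "z \<in> la (max m n)"
          using subsetD[OF root_layer_mono[OF fields, of n "Suc (max m n)"]] by (simp add: la_def)
        moreover have "la m \<subseteq> la (max m n)"
          unfolding la_def by (rule root_layer_mono[OF fields]) simp
        ultimately show ?case using m by blast
      qed simp
      then obtain m where m: "Z \<subseteq> la m" by blast
      have kC: "k \<union> C m \<subseteq> carrier R" using kK KC Cla la(3) by blast
      have "\<exists>T\<subseteq>C m. finite T \<and> Z \<subseteq> gen (k \<union> T)"
        using Z(2) m
      proof induction
        case empty
        then show ?case by blast
      next
        case (insert z Z)
        then obtain T where T: "T \<subseteq> C m" "finite T" "Z \<subseteq> gen (k \<union> T)" by blast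
        have "z \<in> gen (k \<union> C m)" using insert.prems genC by blast
        then obtain U where U: "U \<subseteq> k \<union> C m" "finite U" "z \<in> gen U"
          using kC by (rule gen_finitary)
        let ?T = "T \<union> (U \<inter> C m)"
        have "gen U \<subseteq> gen (k \<union> ?T)" "gen (k \<union> T) \<subseteq> gen (k \<union> ?T)"
          by (rule gen_mono; use U T kC in blast)+
        then have "insert z Z \<subseteq> gen (k \<union> ?T)" using T U by blast
        then show ?case using T U by (intro exI[of _ ?T]) simp
      qed
      then show ?thesis by blast
    qed
  qed
qed

end

theorem mainTheorem5:
  fixes R :: "('a, 'b) ring_scheme" and p :: nat and k L L' K :: "'a set"
  assumes "field R" and "has_char R p" and "p > 0"
    and "subfield k R" and "subfield L R" and "subfield L' R" and "subfield K R"
    and "k \<subseteq> L" and "L \<subseteq> L'" and "L' \<subseteq> K"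
    and "purely_inseparable R p K k"
  shows "di R p L' L \<le>o di R p K k"
proof -
  interpret char_p_field R p
    using assms(1-3) by (intro char_p_field.intro char_p_field_axioms.intro)
  have "|B| \<le>o di R p K k" if "r_base R p (root_layer R p L' L n) L B" for n B
  proof (rule card_r_base_le_di[OF assms(4,7) _ assms(11,8) _ _ that])
    show "k \<subseteq> K" "L \<subseteq> K" "root_layer R p L' L n \<subseteq> K"
      using assms(8-10) by (auto simp: root_layer_def)
  qed
  then show ?thesis
    unfolding di_def[of R p L' L]
    by (intro card_sup_least) (auto simp: card_of_Card_order Card_order_di)
qed

end
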